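(* Let $p\ge1$, $r\ge1$, $n\ge1$ be integers, let $a\in\mathbb{R}^n$ with $y=\sum_{i=1}^n a_i\ne0$, and let $\widehat{y}$ be the result of computing $y$ by recursive summation with limited-precision stochastic rounding $\mathrm{SR}_{p,r}$, that is, $\widehat{s}_1=a_1$, $\widehat{s}_k=\mathrm{SR}_{p,r}(\widehat{s}_{k-1}+a_k)$ for $k=2,\ldots,n$, and $\widehat{y}=\widehat{s}_n$. Then, for any $0<\lambda<1$, $$\frac{|\widehat{y}-y|}{|y|}\le \kappa(a)\left(\sqrt{u_p\,\gamma_{2(n-1)}(u_p)}\,\sqrt{\ln(2/\lambda)}+\gamma_{n-1}(u_p+u_{p+r})-\gamma_{n-1}(u_p)\right)$$ with probability at least $1-\lambda$.
   Context: Notation: $u_q=2^{1-q}$ for an integer $q\ge1$; $\gamma_m(u)=(1+u)^m-1$; $\kappa(a)=\dfrac{\sum_{i=1}^n|a_i|}{\left|\sum_{i=1}^n a_i\right|}$ is the condition number of the sum. Floating-point numbers: $\mathcal{F}$ is the precision-$p$ binary floating-point system, i.e. the set of $0$ and all real numbers $(-1)^s 2^e m$ with $s\in\{0,1\}$, $e$ an integer exponent, and $m\in[1,2)$ having at most $p$ significant bits. Standard model: no underflow or overflow occurs (the exponent range may be regarded as unlimited). For $x\in\mathbb{R}$, $\lceil x\rceil_p=\min\{y\in\mathcal{F}:y\ge x\}$ and $\lfloor x\rfloor_p=\max\{y\in\mathcal{F}:y\le x\}$. For $x\neq0$ written uniquely as $x=(-1)^s2^em$ with $m\in[1,2)$ real,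 $\mathrm{ulp}_p(x)=2^{e-p+1}$, and $\mathrm{fl}_{p+r}(x)$ is $x$ with the binary expansion of its significand $m$ truncated to the first $p+r$ significant bits; $\mathrm{fl}_{p+r}(0)=0$. Limited-precision stochastic rounding with $r$ random bits: $\mathrm{SR}_{p,r}(0)=0$, and for $x\ne0$, $\mathrm{SR}_{p,r}(x)$ is the random variable equal to $\lceil x\rceil_p$ with probability $q_r(x)$ and to $\lfloor x\rfloor_p$ with probability $1-q_r(x)$, where $q_r(x)=(\mathrm{fl}_{p+r}(x)-\lfloor x\rfloor_p)/\mathrm{ulp}_p(x)$. In an algorithm, the inputs are deterministic and each rounding, conditionally on all previous roundings, has this two-point distribution with $x$ the exact result of the current operation. *)

theory Defs
  imports "HOL-Probability.Probability"
begin

text \<open>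
  Binary floating-point numbers of precision \<open>p\<close> with unbounded exponent range; a significand
  \<open>m\<close> in \<open>[1, 2)\<close> has at most \<open>p\<close> significant bits iff \<open>m * 2 ^ (p - 1)\<close> is an integer
  (meaningful for \<open>p \<ge> 1\<close>).
\<close>

definition floats :: "nat \<Rightarrow> real set" where
  "floats p = {0} \<union>
     {(-1) ^ s * 2 powi e * m | (s::nat) (e::int) (m::real).
        s \<in> {0, 1} \<and> 1 \<le> m \<and> m < 2 \<and> m * 2 ^ (p - 1) \<in> \<int>}"

definition round_up_float :: "nat \<Rightarrow> real \<Rightarrow> real" where
  "round_up_float p x = (LEAST y. y \<in> floats p \<and> x \<le> y)"

definition round_down_float :: "nat \<Rightarrow> real \<Rightarrow> real" where
  "round_down_float p x = (GREATEST y. y \<in> floats p \<and> y \<le> x)"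

definition expo :: "real \<Rightarrow> int" where
  "expo x = \<lfloor>log 2 \<bar>x\<bar>\<rfloor>"

definition significand :: "real \<Rightarrow> real" where
  "significand x = \<bar>x\<bar> / 2 powi expo x"

definition ulp :: "nat \<Rightarrow> real \<Rightarrow> real" where
  "ulp p x = 2 powi (expo x - int p + 1)"

text \<open>Truncation of the significand to its first \<open>q\<close> bits, i.e. rounding towards zero.\<close>

definition trunc_float :: "nat \<Rightarrow> real \<Rightarrow> real" where
  "trunc_float q x =
     (if x = 0 then 0
      else sgn x * 2 powi expo x * (of_int \<lfloor>significand x * 2 ^ (q - 1)\<rfloor> / 2 ^ (q - 1)))"

definition prob_up :: "nat \<Rightarrow> nat \<Rightarrow> real \<Rightarrow> real" where
  "prob_up p r x = (trunc_float (p + r) x - round_down_float p x) / ulp p x"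

text \<open>
  The next lemmas show that \<open>prob_up p r x\<close> lies in \<open>[0, 1]\<close> for \<open>p \<ge> 1\<close> and \<open>x \<noteq> 0\<close>, so that
  \<open>bernoulli_pmf\<close>, which clips its argument to \<open>[0, 1]\<close>, leaves it unchanged in \<open>SR\<close> below.
\<close>

lemma expo_bounds:
  assumes "x \<noteq> 0"
  shows "2 powi expo x \<le> \<bar>x\<bar>" and "\<bar>x\<bar> < 2 powi (expo x + 1)"
proof -
  have A: "2 powi e = 2 powr (real_of_int e)" for e :: int
    by (simp add: powr_real_of_int')
  have p: "\<bar>x\<bar> > 0" using assms by simp
  show "2 powi expo x \<le> \<bar>x\<bar>"
    unfolding A expo_def using p
    by (metis le_log_iff of_int_floor_le one_less_numeral_iff semiring_norm(76))
  have "log 2 \<bar>x\<bar> < real_of_int (expo x + 1)" unfolding expo_def by linarith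
  then show "\<bar>x\<bar> < 2 powi (expo x + 1)"
    unfolding A using p by (simp add: log_less_iff)
qed

lemma floats_mult:
  assumes p: "p \<ge> 1" and k: "2 ^ (p - 1) \<le> \<bar>k::int\<bar>" "\<bar>k\<bar> \<le> 2 ^ p"
  shows "of_int k * 2 powi (e - int p + 1) \<in> floats p"
proof -
  define s where "s = (if k < 0 then 1 else 0 :: nat)"
  have ks: "real_of_int k = (-1)^s * \<bar>real_of_int k\<bar>" by (simp add: s_def)
  have q: "(2::real)^p = 2 * 2^(p-1)" using p by (cases p) auto
  have pe: "2 powi (e - int p + 1) = (2 powi e / 2 ^ (p-1) :: real)"
  proof -
    have "e - int p + 1 = e - int (p-1)" using p by simp
    thus ?thesis by (metis power_int_diff power_int_of_nat zero_neq_numeral)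
  qed
  show ?thesis
  proof (cases "\<bar>k\<bar> = 2 ^ p")
    case True
    hence "\<bar>real_of_int k\<bar> = 2^p" by (metis of_int_abs of_int_numeral of_int_power)
    hence "of_int k * 2 powi (e - int p + 1) = (-1)^s * 2 powi (e+1) * (1::real)"
      using ks q pe by (simp add: power_int_add)
    moreover have "(1::real) * 2^(p-1) \<in> \<int>" by simp
    ultimately show ?thesis unfolding floats_def s_def
      by (auto intro!: exI[of _ s] exI[of _ "e+1"] exI[of _ "1::real"] simp: s_def)
  next
    case False
    define m where "m = \<bar>real_of_int k\<bar> / 2^(p-1)"
    have "\<bar>k\<bar> < 2^p" using False k by simp
    hence a: "\<bar>real_of_int k\<bar> < 2^p" by (metis of_int_abs of_int_less_iff of_int_numeral of_int_power)
    have b: "\<bar>real_of_int k\<bar> \<ge> 2^(p-1)" using k(1)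
      by (metis of_int_abs of_int_le_iff of_int_numeral of_int_power)
    have "1 \<le> m" "m < 2" "m * 2^(p-1) \<in> \<int>" using a b q by (auto simp: m_def field_simps)
    moreover have "of_int k * 2 powi (e - int p + 1) = (-1)^s * 2 powi e * m"
      unfolding pe m_def by (subst ks) simp
    moreover have "s \<in> {0,1}" by (simp add: s_def)
    ultimately show ?thesis unfolding floats_def by blast
  qed
qed

lemma round_down_float_eq:
  assumes p: "p \<ge> 1" and x: "x \<noteq> 0"
  shows "round_down_float p x = of_int \<lfloor>x / ulp p x\<rfloor> * ulp p x"
proof -
  define e where "e = expo x" define h where "h = ulp p x" define k where "k = \<lfloor>x / h\<rfloor>"
  have h0: "h > 0" by (simp add: h_def ulp_def)
  have he: "2 powi e = h * 2^(p-1)" 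
  proof -
    have "e = (e - int p + 1) + int (p-1)" using p by simp
    hence "2 powi e = (2 powi ((e - int p + 1) + int (p-1)) :: real)" by simp
    also have "\<dots> = h * 2^(p-1)" unfolding h_def ulp_def e_def by (subst power_int_add) auto
    finally show ?thesis .
  qed
  have q: "(2::real)^p = 2 * 2^(p-1)" using p by (cases p) auto
  have x1: "h * 2^(p-1) \<le> \<bar>x\<bar>" "\<bar>x\<bar> < h * 2^p"
    using expo_bounds[OF x] he q by (auto simp: e_def[symmetric] power_int_add)
  have k1: "of_int k * h \<le> x" and k2: "x < (of_int k + 1) * h"
    using h0 by (auto simp: k_def floor_divide_lower floor_divide_upper)
  have kb: "2^(p-1) \<le> \<bar>k\<bar> \<and> \<bar>k\<bar> \<le> 2^p"
  proof (cases "x > 0")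
    case True
    have "of_int (2^(p-1)) \<le> x / h" "x / h < of_int (2^p)" using x1 True h0 by (auto simp: field_simps)
    hence "2^(p-1) \<le> k" "k < 2^p" unfolding k_def by (simp_all only: le_floor_iff floor_less_iff)
    thus ?thesis by (smt (verit) zero_le_power)
  next
    case False
    have "of_int (- (2^p)) \<le> x / h" "x / h \<le> of_int (-(2^(p-1)))" using x1 False h0 by (auto simp: field_simps)
    hence "-(2^p) \<le> k" "k \<le> -(2^(p-1))" unfolding k_def by (simp only: le_floor_iff, linarith)
    thus ?thesis by (smt (verit) zero_less_power)
  qed
  have mem: "of_int k * h \<in> floats p"
    using floats_mult[OF p, of k e] kb by (simp add: h_def ulp_def e_def)
  have max: "y \<le> of_int k * h" if y: "y \<in> floats p" "y \<le> x" for y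
  proof (rule ccontr)
    assume "\<not> ?thesis" hence c: "y > of_int k * h" by simp
    show False
    proof (cases "y = 0")
      case True
      hence "k < 0" using c h0 by (simp add: mult_less_0_iff)
      moreover have "x > 0" using y True x by simp
      hence "k \<ge> 0" using h0 by (simp add: k_def)
      ultimately show False by simp
    next
      case False
      then obtain s f m where sm: "s \<in> {0,1::nat}" "y = (-1)^s * 2 powi f * m" "1 \<le> m" "m < 2" "m * 2^(p-1) \<in> \<int>"
        using y unfolding floats_def by auto
      have ay: "\<bar>y\<bar> = 2 powi f * m" using sm by (auto simp: abs_mult)
      show False
      proof (cases "f \<ge> e")
        case True
        obtain j :: int where j: "m * 2^(p-1) = of_int j" using sm(5) by (auto elim: Ints_cases)
        have "2 powi f = (2 powi (e + int (nat (f - e))) :: real)" using True by simp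
        also have "\<dots> = 2 powi e * 2 ^ nat (f-e)" using True by (subst power_int_add) (auto simp: power_int_def)
        finally have "y = (-1)^s * 2^nat (f-e) * (m * 2^(p-1)) * h" using sm(2) he by simp
        hence "y = of_int ((-1)^s * 2^nat (f-e) * j) * h" unfolding j by simp
        then obtain i :: int where i: "y = of_int i * h" by blast
        have "real_of_int k < of_int i" using c i h0 by simp
        hence "k < i" by linarith
        moreover have "of_int i * h < (of_int k + 1) * h" using y(2) k2 i by linarith
        hence "real_of_int i < of_int k + 1" using h0 by simp
        hence "i < k + 1" by linarith
        ultimately show False by linarith
      next
        case F: False
        have "2 powi (f + 1) \<le> (2 powi e :: real)" using F by (intro power_int_increasing) auto
        hence "2 * 2 powi f \<le> (2 powi e :: real)" by (simp add: power_int_add)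
        moreover have "2 powi f * m < 2 powi f * 2" using sm by (intro mult_strict_left_mono) auto
        ultimately have lt: "\<bar>y\<bar> < h * 2^(p-1)" using ay he by linarith
        show False
        proof (cases "x > 0")
          case True
          have "of_int (2^(p-1)) \<le> x / h" using x1 True h0 by (auto simp: field_simps)
          hence "2^(p-1) \<le> k" unfolding k_def by (simp only: le_floor_iff)
          hence "(2^(p-1) :: real) \<le> of_int k" by (metis of_int_le_iff of_int_numeral of_int_power)
          hence "2^(p-1) * h \<le> of_int k * h" using h0 by simp
          thus False using lt c by (simp add: mult.commute)
        next
          case False
          thus False using lt y(2) x1 by linarith
        qed
      qed
    qed
  qed
  have "round_down_float p x = of_int k * h" unfolding round_down_float_def
    using mem k1 max by (intro Greatest_equality) auto
  thus ?thesis by (simp add: k_def h_def)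
qed

lemma prob_up_bounds:
  assumes p: "p \<ge> 1" and x: "x \<noteq> 0"
  shows "0 \<le> prob_up p r x" "prob_up p r x \<le> 1"
proof -
  define h where "h = ulp p x"
  define t where "t = x / h"
  have h0: "h > 0" by (simp add: h_def ulp_def)
  have he: "2 powi expo x = h * 2^(p-1)" 
  proof -
    have "expo x = (expo x - int p + 1) + int (p-1)" using p by simp
    hence "2 powi expo x = (2 powi ((expo x - int p + 1) + int (p-1)) :: real)" by simp
    also have "\<dots> = h * 2^(p-1)" unfolding h_def ulp_def by (subst power_int_add) auto
    finally show ?thesis .
  qed
  have pr: "(2::real)^(p+r-1) = 2^(p-1) * 2^r" using p by (simp add: power_add[symmetric])
  have sg: "significand x * 2^(p+r-1) = \<bar>t\<bar> * 2^r"
    unfolding significand_def he pr t_def using h0 by (simp add: field_simps abs_mult)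
  have tr: "trunc_float (p+r) x = sgn x * (of_int \<lfloor>\<bar>t\<bar> * 2^r\<rfloor> / 2^r) * h"
    unfolding trunc_float_def sg unfolding he pr using x by simp
  have Q: "prob_up p r x = sgn x * (of_int \<lfloor>\<bar>t\<bar> * 2^r\<rfloor> / 2^r) - of_int \<lfloor>t\<rfloor>"
    unfolding prob_up_def tr round_down_float_eq[OF p x] h_def[symmetric] t_def[symmetric]
    using h0 by (simp add: field_simps)
  have up: "of_int \<lfloor>\<bar>t\<bar> * 2^r\<rfloor> / 2^r \<le> \<bar>t\<bar>" by (simp add: pos_divide_le_eq)
  have lo: "of_int \<lfloor>\<bar>t\<bar>\<rfloor> \<le> of_int \<lfloor>\<bar>t\<bar> * 2^r\<rfloor> / (2^r :: real)"
  proof -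
    have "real_of_int (\<lfloor>\<bar>t\<bar>\<rfloor> * 2^r) \<le> \<bar>t\<bar> * 2^r" by simp
    hence "\<lfloor>\<bar>t\<bar>\<rfloor> * 2^r \<le> \<lfloor>\<bar>t\<bar> * 2^r\<rfloor>" by (simp only: le_floor_iff)
    hence "real_of_int (\<lfloor>\<bar>t\<bar>\<rfloor> * 2^r) \<le> of_int \<lfloor>\<bar>t\<bar> * 2^r\<rfloor>" by (simp only: of_int_le_iff)
    thus ?thesis by (simp add: pos_le_divide_eq)
  qed
  have "0 \<le> prob_up p r x \<and> prob_up p r x \<le> 1"
  proof (cases "x > 0")
    case True
    hence "t > 0" using h0 by (simp add: t_def)
    hence "\<bar>t\<bar> = t" by simp
    thus ?thesis unfolding Q using True up lo by simp linarith
  next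
    case False
    hence "t < 0" using h0 x by (simp add: t_def divide_neg_pos)
    hence a: "\<bar>t\<bar> = -t" by simp
    have "- \<lfloor>t\<rfloor> - 1 \<le> \<lfloor>- t\<rfloor>" by linarith
    hence f: "- real_of_int \<lfloor>t\<rfloor> - 1 \<le> of_int \<lfloor>- t\<rfloor>" by linarith
    have g: "of_int \<lfloor>t\<rfloor> \<le> t" by simp
    have sx: "sgn x = -1" using False x by simp
    show ?thesis unfolding Q sx using f g up lo unfolding a by (intro conjI; linarith)
  qed
  thus "0 \<le> prob_up p r x" "prob_up p r x \<le> 1" by auto
qed

definition SR :: "nat \<Rightarrow> nat \<Rightarrow> real \<Rightarrow> real pmf" where
  "SR p r x =
     (if x = 0 then return_pmf 0
      else map_pmf (\<lambda>b. if b then round_up_float p x else round_down_float p x)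
             (bernoulli_pmf (prob_up p r x)))"

text \<open>
  The distribution of the \<open>k\<close>-th computed partial sum of \<open>a 1, a 2, \<dots>\<close>. Monadic binding says
  that each rounding, given the past, is distributed as \<open>SR p r\<close> of the exact result of the
  current operation. The value for \<open>k = 0\<close> is a dummy.
\<close>

fun rec_sum :: "nat \<Rightarrow> nat \<Rightarrow> (nat \<Rightarrow> real) \<Rightarrow> nat \<Rightarrow> real pmf" where
  "rec_sum p r a 0 = return_pmf 0"
| "rec_sum p r a (Suc 0) = return_pmf (a 1)"
| "rec_sum p r a (Suc (Suc k)) =
     bind_pmf (rec_sum p r a (Suc k)) (\<lambda>s. SR p r (s + a (Suc (Suc k))))"

definition unit_u :: "nat \<Rightarrow> real" where
  "unit_u q = 2 powi (1 - int q)"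

definition gam :: "nat \<Rightarrow> real \<Rightarrow> real" where
  "gam m u = (1 + u) ^ m - 1"

definition cond_sum :: "nat \<Rightarrow> (nat \<Rightarrow> real) \<Rightarrow> real" where
  "cond_sum n a = (\<Sum>i=1..n. \<bar>a i\<bar>) / \<bar>\<Sum>i=1..n. a i\<bar>"

end

theory Submission
  imports Defs
begin

text \<open>
  Write \<open>u = unit_u p\<close> and \<open>v = unit_u (p + r)\<close>. Rounding \<open>x\<close> gives a random \<open>s'\<close> whose mean is the
  truncation of \<open>x\<close> to \<open>p + r\<close> bits (\<open>expectation_SR\<close>). The relative error of the rounding thus
  splits into a part \<open>\<alpha>\<close> with conditional mean zero and the deterministic relative error \<open>\<beta>\<close> of the
  truncation, with \<open>\<bar>\<alpha>\<bar> \<le> u\<close> and \<open>\<bar>\<beta>\<bar> \<le> v\<close>.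

  Besides the computed sums \<open>s\<close> with \<open>s' = (s + b) * (1 + \<alpha> + \<beta>)\<close>, where \<open>b\<close> is the next summand,
  consider the sums \<open>t\<close> driven by the same roundings but with all biases removed,
  \<open>t' = (t + b) * (1 + \<alpha>)\<close>. Let \<open>A\<close> be the sum of the absolute values of the summands. The two parts
  of the error bound come from the two parts of \<open>s - y = (s - t) + (t - y)\<close>:

  \<^item> An induction on the recursion gives \<open>\<bar>s - t\<bar> \<le> A * (gam (n - 1) (u + v) - gam (n - 1) u)\<close> surely
    (\<open>rec_sum_pair_bounds\<close>).

  \<^item> The difference between \<open>t\<close> and the exact partial sum is a martingale whose increment
    \<open>(t + b) * \<alpha>\<close> in the rounding after \<open>j\<close> earlier ones has magnitude at most \<open>A * u * (1 + u) ^ j\<close>. Conditioning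
    on the past and applying Hoeffding's lemma at each step, as in the Azuma-Hoeffding inequality,
    bounds its moment generating function (\<open>nn_integral_exp_rec_sum_pair_le\<close>), and Chernoff's bound
    yields the tail estimate (\<open>prob_abs_gt_le_sub_Gaussian\<close>). Summing the squares of the increments
    as a geometric series leads to the bound \<open>u * gam (2 * (n - 1)) u\<close> (\<open>geometric_sum_le_gam\<close>).
\<close>

section \<open>Rounding a single number\<close>

lemma ulp_pos: "ulp p x > 0"
  by (simp add: ulp_def)

lemma two_powi_expo:
  assumes "p \<ge> 1"
  shows "2 powi expo x = ulp p x * 2 ^ (p - 1)"
proof -
  have "expo x = (expo x - int p + 1) + int (p - 1)" using assms by simp
  hence "2 powi expo x = (2 powi ((expo x - int p + 1) + int (p - 1)) :: real)" by simp
  also have "\<dots> = ulp p x * 2 ^ (p - 1)" unfolding ulp_def by (subst power_int_add) auto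
  finally show ?thesis .
qed

lemma scaled_bounds:
  assumes "p \<ge> 1" "x \<noteq> 0"
  shows "2 ^ (p - 1) \<le> \<bar>x / ulp p x\<bar>" "\<bar>x / ulp p x\<bar> < 2 ^ p"
proof -
  have q: "(2::real) ^ p = 2 * 2 ^ (p - 1)" using assms by (cases p) auto
  have "ulp p x * 2 ^ (p - 1) \<le> \<bar>x\<bar>" "\<bar>x\<bar> < ulp p x * 2 ^ p"
    using expo_bounds[OF assms(2)] two_powi_expo[OF assms(1), of x] q
    by (auto simp: power_int_add)
  thus "2 ^ (p - 1) \<le> \<bar>x / ulp p x\<bar>" "\<bar>x / ulp p x\<bar> < 2 ^ p"
    using ulp_pos[of p x] by (auto simp: field_simps)
qed

lemma ulp_le:
  assumes "p \<ge> 1" "x \<noteq> 0"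
  shows "ulp p x \<le> unit_u p * \<bar>x\<bar>"
proof -
  have u: "unit_u p = 1 / 2 ^ (p - 1)"
  proof -
    have "1 - int p = - int (p - 1)" using assms by simp
    thus ?thesis by (simp only: unit_u_def power_int_minus power_int_of_nat divide_inverse mult_1)
  qed
  show ?thesis using scaled_bounds(1)[OF assms] ulp_pos[of p x]
    by (auto simp: u field_simps)
qed

lemma unit_u_pos: "unit_u p > 0"
  by (simp add: unit_u_def)

lemma unit_u_add: "unit_u (p + r) = unit_u p / 2 ^ r"
proof -
  have "1 - int (p + r) = (1 - int p) - int r" by simp
  thus ?thesis unfolding unit_u_def
    by (metis power_int_diff power_int_of_nat zero_neq_numeral)
qed

text \<open>
  A float that is at least as large in magnitude as the leading power of two of \<open>x\<close> lies on the
  grid spanned by the unit in the last place of \<open>x\<close>.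
\<close>

lemma float_on_grid:
  assumes p: "p \<ge> 1" and y: "y \<in> floats p" and le: "2 powi expo x \<le> \<bar>y\<bar>"
  shows "\<exists>i::int. y = of_int i * ulp p x"
proof -
  have "(2::real) powi expo x > 0" by simp
  hence "y \<noteq> 0" using le by (metis abs_zero not_less)
  then obtain s f m where sm: "s \<in> {0, 1::nat}" "y = (-1) ^ s * 2 powi f * m"
      "1 \<le> m" "m < 2" "m * 2 ^ (p - 1) \<in> \<int>"
    using y unfolding floats_def by auto
  have ay: "\<bar>y\<bar> = 2 powi f * m" using sm by (auto simp: abs_mult)
  have fe: "f \<ge> expo x"
  proof (rule ccontr)
    assume "\<not> ?thesis"
    hence "2 powi (f + 1) \<le> (2 powi expo x :: real)" by (intro power_int_increasing) auto
    hence "2 * 2 powi f \<le> (2 powi expo x :: real)" by (simp add: power_int_add)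
    moreover have "2 powi f * m < 2 powi f * 2" using sm by (intro mult_strict_left_mono) auto
    ultimately show False using ay le by linarith
  qed
  obtain j :: int where j: "m * 2 ^ (p - 1) = of_int j" using sm(5) by (auto elim: Ints_cases)
  have "2 powi f = (2 powi (expo x + int (nat (f - expo x))) :: real)" using fe by simp
  also have "\<dots> = 2 powi expo x * 2 ^ nat (f - expo x)"
    by (subst power_int_add) (auto simp: power_int_def)
  finally have "y = (-1) ^ s * 2 ^ nat (f - expo x) * (m * 2 ^ (p - 1)) * ulp p x"
    using sm(2) two_powi_expo[OF p, of x] by simp
  hence "y = of_int ((-1) ^ s * 2 ^ nat (f - expo x) * j) * ulp p x" unfolding j by simp
  thus ?thesis by blast
qed

lemma round_up_float_eq:
  assumes p: "p \<ge> 1" and x: "x \<noteq> 0"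
  shows "round_up_float p x = of_int \<lceil>x / ulp p x\<rceil> * ulp p x"
proof -
  define h where "h = ulp p x"
  define k where "k = \<lceil>x / h\<rceil>"
  have h0: "h > 0" by (simp add: h_def ulp_pos)
  have t: "2 ^ (p - 1) \<le> \<bar>x / h\<bar>" "\<bar>x / h\<bar> < 2 ^ p"
    using scaled_bounds[OF p x] by (auto simp: h_def)
  have k1: "x \<le> of_int k * h"
    using h0 le_of_int_ceiling[of "x / h"] unfolding k_def by (simp only: pos_divide_le_eq)
  have least: "k \<le> i" if "x \<le> of_int i * h" for i
    using that h0 by (simp add: k_def ceiling_le_iff field_simps)
  have kb: "2 ^ (p - 1) \<le> \<bar>k\<bar> \<and> \<bar>k\<bar> \<le> 2 ^ p \<and> (x < 0 \<longrightarrow> k \<le> - (2 ^ (p - 1)))"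
  proof (cases "x > 0")
    case True
    hence "of_int (2 ^ (p - 1)) \<le> x / h" "x / h \<le> of_int (2 ^ p)" using t h0 by auto
    moreover have "x / h \<le> of_int k" by (simp add: k_def)
    ultimately have "real_of_int (2 ^ (p - 1)) \<le> of_int k" by linarith
    hence "2 ^ (p - 1) \<le> k" by (simp only: of_int_le_iff)
    moreover have "k \<le> 2 ^ p"
      using \<open>x / h \<le> of_int (2 ^ p)\<close> unfolding k_def by (simp only: ceiling_le_iff)
    moreover have "(0::int) \<le> 2 ^ (p - 1)" by simp
    ultimately show ?thesis using True by linarith
  next
    case False
    hence "x / h < 0" using x h0 by (simp add: divide_neg_pos)
    hence "of_int (- (2 ^ p)) < x / h" "x / h \<le> of_int (- (2 ^ (p - 1)))"
      using t by (auto simp del: abs_divide)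
    hence "- (2 ^ p) < k" "k \<le> - (2 ^ (p - 1))"
      unfolding k_def by (simp_all only: ceiling_le_iff less_ceiling_iff)
    moreover have "(0::int) \<le> 2 ^ (p - 1)" by simp
    ultimately show ?thesis by linarith
  qed
  have mem: "of_int k * h \<in> floats p"
    using floats_mult[OF p, of k "expo x"] kb by (simp add: h_def ulp_def)
  have min: "of_int k * h \<le> y" if y: "y \<in> floats p" "x \<le> y" for y
  proof (cases "2 powi expo x \<le> \<bar>y\<bar>")
    case True
    then obtain i :: int where "y = of_int i * h"
      using float_on_grid[OF p y(1)] h_def by blast
    thus ?thesis using least[of i] y h0 by simp
  next
    case False
    \<comment> \<open>Then \<open>x\<close> is negative and \<open>y\<close> exceeds the grid point \<open>- 2 powi expo x\<close>.\<close>
    have "x < 0" using False expo_bounds(1)[OF x] y by linarith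
    hence "of_int k \<le> real_of_int (- (2 ^ (p - 1)))" using kb by (simp only: of_int_le_iff)
    hence "of_int k * h \<le> - (2 ^ (p - 1)) * h" using h0 by (intro mult_right_mono) auto
    also have "\<dots> = - (2 powi expo x)" using two_powi_expo[OF p, of x] by (simp add: h_def)
    finally show ?thesis using False by linarith
  qed
  have "round_up_float p x = of_int k * h" unfolding round_up_float_def
    using mem k1 min by (intro Least_equality) auto
  thus ?thesis by (simp add: k_def h_def)
qed

lemma trunc_float_eq:
  assumes p: "p \<ge> 1" and x: "x \<noteq> 0"
  shows "trunc_float (p + r) x = sgn x * (of_int \<lfloor>\<bar>x / ulp p x\<bar> * 2 ^ r\<rfloor> / 2 ^ r) * ulp p x"
proof -
  have pr: "(2::real) ^ (p + r - 1) = 2 ^ (p - 1) * 2 ^ r" using p by (simp add: power_add[symmetric])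
  have sg: "significand x * 2 ^ (p + r - 1) = \<bar>x / ulp p x\<bar> * 2 ^ r"
    unfolding significand_def two_powi_expo[OF p] pr using ulp_pos[of p x]
    by (simp add: field_simps abs_mult)
  show ?thesis
    unfolding trunc_float_def sg unfolding two_powi_expo[OF p] pr using x by simp
qed

lemma abs_trunc_float_diff_le:
  assumes p: "p \<ge> 1"
  shows "\<bar>trunc_float (p + r) x - x\<bar> \<le> unit_u (p + r) * \<bar>x\<bar>"
proof (cases "x = 0")
  case x: False
  define h where "h = ulp p x"
  have h0: "h > 0" by (simp add: h_def ulp_pos)
  define w where "w = \<bar>x / h\<bar> * 2 ^ r"
  have xe: "x = sgn x * (w / 2 ^ r) * h" using h0 by (simp add: w_def sgn_mult_abs)
  have tr: "trunc_float (p + r) x = sgn x * (of_int \<lfloor>w\<rfloor> / 2 ^ r) * h"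
    unfolding trunc_float_eq[OF p x] w_def h_def ..
  have "trunc_float (p + r) x - x = sgn x * ((of_int \<lfloor>w\<rfloor> - w) / 2 ^ r) * h"
    unfolding tr by (subst (2) xe) (simp add: algebra_simps diff_divide_distrib)
  hence "\<bar>trunc_float (p + r) x - x\<bar> = \<bar>of_int \<lfloor>w\<rfloor> - w\<bar> / 2 ^ r * h"
    using x h0 by (simp add: abs_mult abs_sgn_eq)
  also have "\<dots> \<le> 1 / 2 ^ r * h"
  proof (intro mult_right_mono divide_right_mono)
    show "\<bar>of_int \<lfloor>w\<rfloor> - w\<bar> \<le> 1" by linarith
  qed (use h0 in auto)
  also have "\<dots> \<le> unit_u (p + r) * \<bar>x\<bar>"
    using ulp_le[OF p x] unfolding unit_u_add h_def by (auto simp: field_simps)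
  finally show ?thesis .
qed (simp add: trunc_float_def)

lemma trunc_float_eq_prob_up:
  "trunc_float (p + r) x = round_down_float p x + prob_up p r x * ulp p x"
  using ulp_pos[of p x] by (simp add: prob_up_def)

text \<open>
  If \<open>x\<close> is a float, then both roundings and the truncation are equal to \<open>x\<close>; otherwise the two
  neighbours of \<open>x\<close> are one unit in the last place apart.
\<close>

lemma round_up_float_cases:
  assumes p: "p \<ge> 1" and x: "x \<noteq> 0"
  shows "round_up_float p x = round_down_float p x + ulp p x \<or>
     round_up_float p x = round_down_float p x \<and> prob_up p r x = 0"
proof (cases "x / ulp p x \<in> \<int>")
  case True
  then obtain i where i: "x / ulp p x = of_int i" by (auto elim: Ints_cases)
  have "\<lfloor>\<bar>x / ulp p x\<bar> * 2 ^ r\<rfloor> = \<bar>i\<bar> * 2 ^ r"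
    unfolding i by (rule floor_unique) simp_all
  hence "trunc_float (p + r) x = sgn x * \<bar>x / ulp p x\<bar> * ulp p x"
    unfolding trunc_float_eq[OF p x] by (simp add: i)
  also have "\<dots> = x" using ulp_pos[of p x] by (simp add: sgn_mult_abs)
  also have "x = of_int i * ulp p x" using i ulp_pos[of p x] by (simp add: field_simps)
  finally have "trunc_float (p + r) x = of_int i * ulp p x" .
  thus ?thesis
    using round_up_float_eq[OF p x] round_down_float_eq[OF p x] by (simp add: i prob_up_def)
next
  case False
  hence "\<lceil>x / ulp p x\<rceil> = \<lfloor>x / ulp p x\<rfloor> + 1"
    by (metis Ints_of_int ceiling_altdef)
  thus ?thesis
    using round_up_float_eq[OF p x] round_down_float_eq[OF p x] by (simp add: algebra_simps)
qed

section \<open>Limited-precision stochastic rounding\<close>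

lemma finite_set_SR: "finite (set_pmf (SR p r x))"
  by (simp add: SR_def)

text \<open>
  Stochastic rounding with finitely many random bits is an unbiased rounding of the truncated
  number; the bias with respect to the number itself is the truncation error.
\<close>

lemma expectation_SR:
  assumes p: "p \<ge> 1"
  shows "measure_pmf.expectation (SR p r x) (\<lambda>s. s) = trunc_float (p + r) x"
proof (cases "x = 0")
  case x: False
  have "measure_pmf.expectation (SR p r x) (\<lambda>s. s) =
      round_up_float p x * prob_up p r x + round_down_float p x * (1 - prob_up p r x)"
    using x prob_up_bounds[OF p x, of r] by (simp add: SR_def)
  also have "\<dots> = trunc_float (p + r) x"
    using round_up_float_cases[OF p x, of r] unfolding trunc_float_eq_prob_up
    by (auto simp: algebra_simps)
  finally show ?thesis .
qed (simp add: SR_def trunc_float_def)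

lemma abs_SR_diff_trunc_float_le:
  assumes p: "p \<ge> 1" and s: "s \<in> set_pmf (SR p r x)"
  shows "\<bar>s - trunc_float (p + r) x\<bar> \<le> unit_u p * \<bar>x\<bar>"
proof (cases "x = 0")
  case x: False
  have "s = round_up_float p x \<or> s = round_down_float p x"
    using s x by (auto simp: SR_def split: if_splits)
  moreover have "0 \<le> prob_up p r x * ulp p x" "prob_up p r x * ulp p x \<le> ulp p x"
    using prob_up_bounds[OF p x, of r] ulp_pos[of p x]
    by (auto intro: mult_left_le_one_le)
  ultimately have "\<bar>s - trunc_float (p + r) x\<bar> \<le> ulp p x"
    using round_up_float_cases[OF p x, of r] unfolding trunc_float_eq_prob_up by auto
  thus ?thesis using ulp_le[OF p x] by linarith
qed (use s in \<open>simp add: SR_def trunc_float_def\<close>)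

section \<open>The coupled unbiased recursion\<close>

text \<open>
  The joint distribution of the \<open>k\<close>-th computed partial sum and of the partial sum that results
  if every relative rounding error is replaced by its centred part
  \<open>(s' - trunc_float (p + r) x) / x\<close>, where \<open>x\<close> is the exact result of the operation and \<open>s'\<close> its
  rounding. For \<open>x = 0\<close> the rounding is exact and division by zero gives the value \<open>0\<close>, as it
  should. The value for \<open>k = 0\<close> is a dummy.
\<close>

fun rec_sum_pair :: "nat \<Rightarrow> nat \<Rightarrow> (nat \<Rightarrow> real) \<Rightarrow> nat \<Rightarrow> (real \<times> real) pmf" where
  "rec_sum_pair p r a 0 = return_pmf (0, 0)"
| "rec_sum_pair p r a (Suc 0) = return_pmf (a 1, a 1)"
| "rec_sum_pair p r a (Suc (Suc k)) =
     bind_pmf (rec_sum_pair p r a (Suc k)) (\<lambda>(s, t).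
       map_pmf (\<lambda>s'. (s', (t + a (Suc (Suc k))) *
           (1 + (s' - trunc_float (p + r) (s + a (Suc (Suc k)))) / (s + a (Suc (Suc k))))))
         (SR p r (s + a (Suc (Suc k)))))"

lemma map_fst_rec_sum_pair: "map_pmf fst (rec_sum_pair p r a k) = rec_sum p r a k"
proof (induction p r a k rule: rec_sum_pair.induct)
  case (3 p r a k)
  have "map_pmf fst (rec_sum_pair p r a (Suc (Suc k))) =
      bind_pmf (map_pmf fst (rec_sum_pair p r a (Suc k))) (\<lambda>s. SR p r (s + a (Suc (Suc k))))"
    by (simp add: map_bind_pmf bind_map_pmf case_prod_unfold pmf.map_comp o_def)
  thus ?case using 3 by simp
qed simp_all

text \<open>
  Both bounds hold surely, since the centred relative errors are at most \<open>u\<close> and the biases at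
  most \<open>v\<close> in magnitude. The second bound rests on the recursion
  \<open>s' - t' = (s - t) * (1 + \<alpha> + \<beta>) + (t + b) * \<beta>\<close> for the difference.
\<close>

lemma rec_sum_pair_bounds:
  fixes a :: "nat \<Rightarrow> real"
  assumes p: "p \<ge> 1" and st: "(s, t) \<in> set_pmf (rec_sum_pair p r a (Suc k))"
  defines "u \<equiv> unit_u p" and "v \<equiv> unit_u (p + r)"
  shows "\<bar>t\<bar> \<le> (\<Sum>i=1..Suc k. \<bar>a i\<bar>) * (1 + u) ^ k"
    and "\<bar>s - t\<bar> \<le> (\<Sum>i=1..Suc k. \<bar>a i\<bar>) * ((1 + u + v) ^ k - (1 + u) ^ k)"
  using st
proof (induction k arbitrary: s t)
  case 0
  { case 1 thus ?case by simp next case 2 thus ?case by simp }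
next
  case (Suc k)
  have u0: "u > 0" and v0: "v > 0" by (simp_all add: u_def v_def unit_u_pos)
  define A where "A = (\<Sum>i=1..Suc k. \<bar>a i\<bar>)"
  define b where "b = a (Suc (Suc k))"
  have A0: "A \<ge> 0" unfolding A_def by (intro sum_nonneg) auto
  have A': "(\<Sum>i=1..Suc (Suc k). \<bar>a i\<bar>) = A + \<bar>b\<bar>" by (simp add: A_def b_def)
  have pw: "1 \<le> (1 + u) ^ k" "(1 + u) ^ k \<le> (1 + u + v) ^ k"
    using u0 v0 by (auto intro: one_le_power power_mono)
  have *: "\<bar>t\<bar> \<le> (A + \<bar>b\<bar>) * (1 + u) ^ Suc k \<and>
      \<bar>s - t\<bar> \<le> (A + \<bar>b\<bar>) * ((1 + u + v) ^ Suc k - (1 + u) ^ Suc k)"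
    if new: "(s, t) \<in> set_pmf (rec_sum_pair p r a (Suc (Suc k)))" for s t
  proof -
    obtain s0 t0 where st0: "(s0, t0) \<in> set_pmf (rec_sum_pair p r a (Suc k))"
      and s: "s \<in> set_pmf (SR p r (s0 + b))"
      and t: "t = (t0 + b) * (1 + (s - trunc_float (p + r) (s0 + b)) / (s0 + b))"
      using new unfolding b_def by auto
    define x where "x = s0 + b"
    define al where "al = (s - trunc_float (p + r) x) / x"
    define be where "be = (trunc_float (p + r) x - x) / x"
    have al: "\<bar>al\<bar> \<le> u"
      using abs_SR_diff_trunc_float_le[OF p s[folded x_def]] u0
      by (cases "x = 0") (auto simp: al_def u_def divide_simps)
    have be: "\<bar>be\<bar> \<le> v"
      using abs_trunc_float_diff_le[OF p, of r x] v0
      by (cases "x = 0") (auto simp: be_def v_def divide_simps)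
    \<comment> \<open>For \<open>x = 0\<close> both sides vanish, because zero is rounded exactly.\<close>
    have sx: "s = x * (1 + al + be)"
    proof (cases "x = 0")
      case True thus ?thesis using s by (simp add: SR_def x_def)
    qed (simp add: al_def be_def field_simps)
    have tx: "t = (t0 + b) * (1 + al)" using t by (simp add: al_def x_def)
    have ih: "\<bar>t0\<bar> \<le> A * (1 + u) ^ k" "\<bar>s0 - t0\<bar> \<le> A * ((1 + u + v) ^ k - (1 + u) ^ k)"
      using Suc.IH[OF st0] by (auto simp: A_def)
    have "\<bar>t0 + b\<bar> \<le> A * (1 + u) ^ k + \<bar>b\<bar> * 1" using ih by linarith
    also have "\<dots> \<le> A * (1 + u) ^ k + \<bar>b\<bar> * (1 + u) ^ k"
      using pw by (intro add_left_mono mult_left_mono) auto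
    finally have tb: "\<bar>t0 + b\<bar> \<le> (A + \<bar>b\<bar>) * (1 + u) ^ k" by (simp add: algebra_simps)
    have "\<bar>t\<bar> \<le> (A + \<bar>b\<bar>) * (1 + u) ^ k * (1 + u)"
      unfolding tx abs_mult using tb al A0 u0 by (intro mult_mono) auto
    moreover have "\<bar>s - t\<bar> \<le> (A + \<bar>b\<bar>) * ((1 + u + v) ^ Suc k - (1 + u) ^ Suc k)"
    proof -
      have "s - t = (s0 - t0) * (1 + al + be) + (t0 + b) * be"
        unfolding sx tx x_def by (simp add: algebra_simps)
      hence "\<bar>s - t\<bar> \<le> \<bar>s0 - t0\<bar> * \<bar>1 + al + be\<bar> + \<bar>t0 + b\<bar> * \<bar>be\<bar>"
        by (metis abs_mult abs_triangle_ineq)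
      also have "\<dots> \<le> (A * ((1 + u + v) ^ k - (1 + u) ^ k)) * (1 + u + v)
          + ((A + \<bar>b\<bar>) * (1 + u) ^ k) * v"
        using ih tb al be A0 u0 v0 pw by (intro add_mono mult_mono) auto
      also have "\<dots> \<le> ((A + \<bar>b\<bar>) * ((1 + u + v) ^ k - (1 + u) ^ k)) * (1 + u + v)
          + ((A + \<bar>b\<bar>) * (1 + u) ^ k) * v"
        using u0 v0 pw by (intro add_right_mono mult_right_mono) auto
      also have "\<dots> = (A + \<bar>b\<bar>) * ((1 + u + v) ^ Suc k - (1 + u) ^ Suc k)"
        by (simp add: algebra_simps)
      finally show ?thesis .
    qed
    ultimately show ?thesis by (simp add: mult.assoc mult.commute[of "1 + u"])
  qed
  { case 1 thus ?case using * unfolding A' by blast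
  next
    case 2 thus ?case using * unfolding A' by blast }
qed

section \<open>Concentration of the unbiased recursion\<close>

text \<open>Hoeffding's lemma for a centred variable, with an exponent of either sign.\<close>

lemma nn_integral_exp_le_Hoeffding:
  fixes M :: "'a pmf" and f :: "'a \<Rightarrow> real"
  assumes bd: "\<And>x. x \<in> set_pmf M \<Longrightarrow> \<bar>f x\<bar> \<le> c"
    and E0: "measure_pmf.expectation M f = 0"
  shows "(\<integral>\<^sup>+x. ennreal (exp (\<theta> * f x)) \<partial>M) \<le> ennreal (exp (\<theta>\<^sup>2 * c\<^sup>2 / 2))"
proof -
  have pos: "(\<integral>\<^sup>+x. ennreal (exp (l * g x)) \<partial>M) \<le> ennreal (exp (l\<^sup>2 * c\<^sup>2 / 2))"
    if "l > 0" "\<And>x. x \<in> set_pmf M \<Longrightarrow> \<bar>g x\<bar> \<le> c" "measure_pmf.expectation M g = 0"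
    for l :: real and g :: "'a \<Rightarrow> real"
  proof -
    interpret interval_bounded_random_variable "measure_pmf M" g "- c" c
      by unfold_locales (use that(2) in \<open>auto simp: AE_measure_pmf_iff abs_le_iff minus_le_iff\<close>)
    have "(c - - c)\<^sup>2 = 4 * c\<^sup>2" by (simp add: power2_eq_square algebra_simps)
    thus ?thesis using Hoeffdings_lemma_nn_integral_0[OF that(1,3)]
      by (simp add: mult.commute)
  qed
  consider "\<theta> > 0" | "\<theta> = 0" | "- \<theta> > 0" by linarith
  thus ?thesis
  proof cases
    case 3
    show ?thesis using pos[OF 3, of "\<lambda>x. - f x"] bd E0 by simp
  qed (use pos[of \<theta> f] bd E0 in auto)
qed

text \<open>
  The error of the unbiased recursion is sub-Gaussian. The variance proxy is a bound for the sum of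
  the squared martingale increments: each earlier rounding enlarges a
  partial sum by a factor of at most \<open>1 + u\<close>.
\<close>

lemma nn_integral_exp_rec_sum_pair_le:
  fixes a :: "nat \<Rightarrow> real" and \<theta> :: real
  assumes p: "p \<ge> 1"
  defines "u \<equiv> unit_u p"
  shows "(\<integral>\<^sup>+z. ennreal (exp (\<theta> * (snd z - (\<Sum>i=1..Suc k. a i)))) \<partial>rec_sum_pair p r a (Suc k))
     \<le> ennreal (exp (\<theta>\<^sup>2 * ((\<Sum>i=1..Suc k. \<bar>a i\<bar>)\<^sup>2 * u\<^sup>2 * (\<Sum>j<k. (1 + u) ^ (2 * j))) / 2))"
proof (induction k)
  case 0
  show ?case by (simp add: one_ennreal.rep_eq flip: one_ennreal_def)
next
  case (Suc k)
  have u0: "u > 0" by (simp add: u_def unit_u_pos)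
  define A where "A = (\<Sum>i=1..Suc k. \<bar>a i\<bar>)"
  define b where "b = a (Suc (Suc k))"
  define S where "S = (\<Sum>i=1..Suc k. a i)"
  define G where "G = (\<Sum>j<k. (1 + u) ^ (2 * j))"
  define c where "c = (A + \<bar>b\<bar>) * (1 + u) ^ k * u"
  have A0: "A \<ge> 0" unfolding A_def by (intro sum_nonneg) auto
  have G0: "G \<ge> 0" unfolding G_def using u0 by (intro sum_nonneg) auto
  have A': "(\<Sum>i=1..Suc (Suc k). \<bar>a i\<bar>) = A + \<bar>b\<bar>" by (simp add: A_def b_def)
  have S': "(\<Sum>i=1..Suc (Suc k). a i) = S + b" by (simp add: S_def b_def)
  define al where "al = (\<lambda>s s'. (s' - trunc_float (p + r) (s + b)) / (s + b))"
  \<comment> \<open>One step of the recursion, conditionally on the past.\<close>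
  have inner: "(\<integral>\<^sup>+s'. ennreal (exp (\<theta> * ((t + b) * (1 + al s s') - (S + b)))) \<partial>SR p r (s + b))
      \<le> ennreal (exp (\<theta> * (t - S))) * ennreal (exp (\<theta>\<^sup>2 * c\<^sup>2 / 2))"
    if st: "(s, t) \<in> set_pmf (rec_sum_pair p r a (Suc k))" for s t
  proof -
    have pw: "1 \<le> (1 + u) ^ k" using u0 by (auto intro: one_le_power)
    have "\<bar>t + b\<bar> \<le> A * (1 + u) ^ k + \<bar>b\<bar> * 1"
      using rec_sum_pair_bounds(1)[OF p st] by (simp add: A_def u_def)
    also have "\<dots> \<le> A * (1 + u) ^ k + \<bar>b\<bar> * (1 + u) ^ k"
      using pw by (intro add_left_mono mult_left_mono) auto
    finally have tb: "\<bar>t + b\<bar> \<le> (A + \<bar>b\<bar>) * (1 + u) ^ k" by (simp add: algebra_simps)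
    have bd: "\<bar>(t + b) * al s s'\<bar> \<le> c" if "s' \<in> set_pmf (SR p r (s + b))" for s'
    proof -
      have "\<bar>al s s'\<bar> \<le> u"
        using abs_SR_diff_trunc_float_le[OF p that] u0
        by (cases "s + b = 0") (auto simp: al_def u_def divide_simps)
      thus ?thesis unfolding c_def abs_mult using tb A0 u0 by (intro mult_mono) auto
    qed
    have int: "integrable (SR p r (s + b)) (f :: real \<Rightarrow> real)" for f
      by (intro integrable_measure_pmf_finite finite_set_SR)
    have "measure_pmf.expectation (SR p r (s + b)) (\<lambda>s'. s' - trunc_float (p + r) (s + b)) = 0"
      by (subst Bochner_Integration.integral_diff[OF int int]) (simp add: expectation_SR[OF p])
    hence E0: "measure_pmf.expectation (SR p r (s + b)) (\<lambda>s'. (t + b) * al s s') = 0"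
      by (simp add: al_def)
    have "exp (\<theta> * ((t + b) * (1 + al s s') - (S + b))) =
        exp (\<theta> * (t - S)) * exp (\<theta> * ((t + b) * al s s'))" for s'
      by (simp add: algebra_simps flip: exp_add)
    hence "(\<integral>\<^sup>+s'. ennreal (exp (\<theta> * ((t + b) * (1 + al s s') - (S + b)))) \<partial>SR p r (s + b)) =
        ennreal (exp (\<theta> * (t - S))) *
          (\<integral>\<^sup>+s'. ennreal (exp (\<theta> * ((t + b) * al s s'))) \<partial>SR p r (s + b))"
      by (simp add: ennreal_mult nn_integral_cmult)
    also have "\<dots> \<le> ennreal (exp (\<theta> * (t - S))) * ennreal (exp (\<theta>\<^sup>2 * c\<^sup>2 / 2))"
      by (intro mult_left_mono nn_integral_exp_le_Hoeffding bd E0) auto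
    finally show ?thesis .
  qed
  have "(\<integral>\<^sup>+z. ennreal (exp (\<theta> * (snd z - (S + b)))) \<partial>rec_sum_pair p r a (Suc (Suc k))) =
      (\<integral>\<^sup>+z. (\<integral>\<^sup>+s'. ennreal (exp (\<theta> * ((snd z + b) * (1 + al (fst z) s') - (S + b))))
         \<partial>SR p r (fst z + b)) \<partial>rec_sum_pair p r a (Suc k))"
    by (simp add: case_prod_unfold b_def al_def)
  also have "\<dots> \<le> (\<integral>\<^sup>+z. ennreal (exp (\<theta> * (snd z - S))) * ennreal (exp (\<theta>\<^sup>2 * c\<^sup>2 / 2))
      \<partial>rec_sum_pair p r a (Suc k))"
    by (intro nn_integral_mono_AE) (auto simp: AE_measure_pmf_iff intro!: inner)
  also have "\<dots> = (\<integral>\<^sup>+z. ennreal (exp (\<theta> * (snd z - S))) \<partial>rec_sum_pair p r a (Suc k))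
      * ennreal (exp (\<theta>\<^sup>2 * c\<^sup>2 / 2))"
    by (simp add: nn_integral_multc)
  also have "\<dots> \<le> ennreal (exp (\<theta>\<^sup>2 * (A\<^sup>2 * u\<^sup>2 * G) / 2)) * ennreal (exp (\<theta>\<^sup>2 * c\<^sup>2 / 2))"
    using Suc.IH unfolding A_def S_def G_def by (intro mult_right_mono) auto
  also have "\<dots> = ennreal (exp (\<theta>\<^sup>2 * (A\<^sup>2 * u\<^sup>2 * G + c\<^sup>2) / 2))"
    by (simp add: algebra_simps add_divide_distrib flip: ennreal_mult exp_add)
  also have "\<dots> \<le> ennreal (exp (\<theta>\<^sup>2 * ((A + \<bar>b\<bar>)\<^sup>2 * u\<^sup>2 * (G + (1 + u) ^ (2 * k))) / 2))"
  proof -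
    have "A\<^sup>2 * u\<^sup>2 * G \<le> (A + \<bar>b\<bar>)\<^sup>2 * u\<^sup>2 * G"
      using A0 G0 by (intro mult_right_mono power_mono) auto
    moreover have "c\<^sup>2 = (A + \<bar>b\<bar>)\<^sup>2 * u\<^sup>2 * (1 + u) ^ (2 * k)"
      by (simp add: c_def power_mult_distrib power_mult[symmetric] mult.commute mult.left_commute)
    ultimately have "A\<^sup>2 * u\<^sup>2 * G + c\<^sup>2 \<le> (A + \<bar>b\<bar>)\<^sup>2 * u\<^sup>2 * (G + (1 + u) ^ (2 * k))"
      by (simp add: distrib_left)
    thus ?thesis by (intro ennreal_leI) (auto intro!: mult_left_mono divide_right_mono)
  qed
  finally show ?case unfolding A' S' by (simp add: G_def)
qed

text \<open>The Chernoff bound for a sub-Gaussian variable with variance proxy \<open>V\<close>, for both tails.\<close>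

lemma prob_abs_gt_le_sub_Gaussian:
  fixes M :: "'a pmf" and f :: "'a \<Rightarrow> real"
  assumes mgf: "\<And>\<theta>. (\<integral>\<^sup>+x. ennreal (exp (\<theta> * f x)) \<partial>M) \<le> ennreal (exp (\<theta>\<^sup>2 * V / 2))"
    and V: "V > 0" and lam: "0 < lam" "lam < 1"
  shows "measure_pmf.prob M {x. \<bar>f x\<bar> > sqrt (2 * V * ln (2 / lam))} \<le> lam"
proof -
  define \<tau> where "\<tau> = sqrt (2 * V * ln (2 / lam))"
  have ln0: "ln (2 / lam) > 0" using lam by simp
  have \<tau>: "\<tau> > 0" "\<tau>\<^sup>2 = 2 * V * ln (2 / lam)" using V ln0 by (auto simp: \<tau>_def)
  have tail: "measure_pmf.prob M {x. g x \<ge> \<tau>} \<le> lam / 2"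
    if g: "\<And>\<theta>. (\<integral>\<^sup>+x. ennreal (exp (\<theta> * g x)) \<partial>M) \<le> ennreal (exp (\<theta>\<^sup>2 * V / 2))"
    for g :: "'a \<Rightarrow> real"
  proof -
    \<comment> \<open>This choice minimises the exponent \<open>- \<theta> * \<tau> + \<theta>\<^sup>2 * V / 2\<close> of the Chernoff bound.\<close>
    define \<theta> where "\<theta> = \<tau> / V"
    have "\<theta> > 0" using \<tau> V by (simp add: \<theta>_def)
    hence "emeasure M {x \<in> UNIV. g x \<ge> \<tau>} \<le>
        ennreal (exp (- \<theta> * \<tau>)) * (\<integral>\<^sup>+x. ennreal (exp (\<theta> * g x)) * indicator UNIV x \<partial>M)"
      by (intro Chernoff_ineq_nn_integral_ge) auto
    also have "\<dots> \<le> ennreal (exp (- \<theta> * \<tau>)) * ennreal (exp (\<theta>\<^sup>2 * V / 2))"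
      using g[of \<theta>] by (intro mult_left_mono) auto
    also have "\<dots> = ennreal (exp (- \<theta> * \<tau> + \<theta>\<^sup>2 * V / 2))"
      by (simp flip: ennreal_mult exp_add)
    also have "- \<theta> * \<tau> + \<theta>\<^sup>2 * V / 2 = - (\<tau>\<^sup>2 / (2 * V))"
      using V by (simp add: \<theta>_def field_simps power2_eq_square)
    also have "\<dots> = - ln (2 / lam)" using V by (simp add: \<tau>)
    also have "exp \<dots> = lam / 2" using lam by (simp add: exp_minus)
    finally show ?thesis using lam by (simp add: measure_pmf.emeasure_eq_measure)
  qed
  have "measure_pmf.prob M {x. \<bar>f x\<bar> > \<tau>} \<le>
      measure_pmf.prob M ({x. f x \<ge> \<tau>} \<union> {x. - f x \<ge> \<tau>})"
    by (intro measure_pmf.finite_measure_mono) auto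
  also have "\<dots> \<le> measure_pmf.prob M {x. f x \<ge> \<tau>} + measure_pmf.prob M {x. - f x \<ge> \<tau>}"
    by (intro measure_Un_le) auto
  also have "\<dots> \<le> lam / 2 + lam / 2"
  proof (intro add_mono tail)
    fix \<theta> :: real
    show "(\<integral>\<^sup>+x. ennreal (exp (\<theta> * - f x)) \<partial>M) \<le> ennreal (exp (\<theta>\<^sup>2 * V / 2))"
      using mgf[of "- \<theta>"] by simp
  qed (rule mgf)
  finally show ?thesis by (simp add: \<tau>_def)
qed

section \<open>The probabilistic error bound\<close>

text \<open>
  The quotient of the geometric series is \<open>(1 + u)\<^sup>2\<close>, and \<open>(1 + u)\<^sup>2 - 1 \<ge> 2 * u\<close>; the factor \<open>2\<close> cancels
  the one in the sub-Gaussian deviation \<open>sqrt (2 * V * ln (2 / lam))\<close>.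
\<close>

lemma geometric_sum_le_gam:
  assumes "u > 0"
  shows "2 * (u\<^sup>2 * (\<Sum>j<k. (1 + u) ^ (2 * j))) \<le> u * gam (2 * k) u"
proof -
  have G0: "(\<Sum>j<k. (1 + u) ^ (2 * j)) \<ge> 0" using assms by (intro sum_nonneg) auto
  have "gam (2 * k) u = ((1 + u)\<^sup>2) ^ k - 1" by (simp add: gam_def power_mult)
  also have "\<dots> = ((1 + u)\<^sup>2 - 1) * (\<Sum>j<k. ((1 + u)\<^sup>2) ^ j)" by (rule power_diff_1_eq)
  also have "\<dots> = (2 * u + u\<^sup>2) * (\<Sum>j<k. (1 + u) ^ (2 * j))"
    by (simp only: power_mult) (simp add: power2_eq_square algebra_simps)
  finally have "u * gam (2 * k) u = (2 * u\<^sup>2 + u ^ 3) * (\<Sum>j<k. (1 + u) ^ (2 * j))"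
    by (simp add: algebra_simps power2_eq_square power3_eq_cube)
  moreover have "2 * u\<^sup>2 * (\<Sum>j<k. (1 + u) ^ (2 * j)) \<le>
      (2 * u\<^sup>2 + u ^ 3) * (\<Sum>j<k. (1 + u) ^ (2 * j))"
    using G0 assms by (intro mult_right_mono) auto
  ultimately show ?thesis by (simp add: mult.assoc)
qed

theorem theorem3:
  fixes p r n :: nat and a :: "nat \<Rightarrow> real" and y lam :: real
  assumes "p \<ge> 1" and "r \<ge> 1" and "n \<ge> 1"
    and "y = (\<Sum>i=1..n. a i)" and "y \<noteq> 0"
    and "0 < lam" and "lam < 1"
  shows "measure_pmf.prob (rec_sum p r a n)
           {yhat. \<bar>yhat - y\<bar> / \<bar>y\<bar> \<le>
              cond_sum n a *
                (sqrt (unit_u p * gam (2 * (n - 1)) (unit_u p)) * sqrt (ln (2 / lam))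
                 + gam (n - 1) (unit_u p + unit_u (p + r)) - gam (n - 1) (unit_u p))}
         \<ge> 1 - lam"
proof -
  define u where "u = unit_u p"
  define v where "v = unit_u (p + r)"
  define A where "A = (\<Sum>i=1..n. \<bar>a i\<bar>)"
  obtain k where n: "n = Suc k" using assms(3) by (cases n) auto
  define V where "V = A\<^sup>2 * u\<^sup>2 * (\<Sum>j<k. (1 + u) ^ (2 * j))"
  define R where "R = sqrt (u * gam (2 * k) u) * sqrt (ln (2 / lam))"
  define M where "M = rec_sum_pair p r a n"
  have u0: "u > 0" by (simp add: u_def unit_u_pos)
  have "\<bar>y\<bar> \<le> A" unfolding assms(4) A_def by (rule sum_abs)
  hence A0: "A > 0" using assms(5) by linarith
  have ln0: "ln (2 / lam) > 0" using assms(6,7) by simp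
  have conc: "measure_pmf.prob M {z. \<bar>snd z - y\<bar> > A * R} \<le> lam"
  proof (cases "k = 0")
    \<comment> \<open>Without any rounding the variance proxy vanishes, but the sum is exact.\<close>
    case True
    hence "{z. \<bar>snd z - y\<bar> > A * R} \<inter> set_pmf M = {}"
      using n assms(4) A0 by (auto simp: M_def R_def gam_def)
    hence "measure_pmf.prob M {z. \<bar>snd z - y\<bar> > A * R} = 0"
      by (simp add: measure_pmf_zero_iff Int_commute)
    thus ?thesis using assms(6) by simp
  next
    case False
    have "(\<Sum>j<k. (1 + u) ^ (2 * j)) > 0" using False u0 by (intro sum_pos) auto
    hence V0: "V > 0" using A0 u0 by (simp add: V_def)
    have "2 * V = A\<^sup>2 * (2 * (u\<^sup>2 * (\<Sum>j<k. (1 + u) ^ (2 * j))))" by (simp add: V_def)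
    also have "\<dots> \<le> A\<^sup>2 * (u * gam (2 * k) u)"
      using geometric_sum_le_gam[OF u0, of k] by (intro mult_left_mono) auto
    finally have "sqrt (2 * V * ln (2 / lam)) \<le> sqrt (A\<^sup>2 * (u * gam (2 * k) u) * ln (2 / lam))"
      using ln0 by (intro real_sqrt_le_mono mult_right_mono) auto
    also have "\<dots> = A * R" using A0 by (simp add: R_def real_sqrt_mult)
    finally have le: "sqrt (2 * V * ln (2 / lam)) \<le> A * R" .
    have "measure_pmf.prob M {z. \<bar>snd z - y\<bar> > A * R} \<le>
        measure_pmf.prob M {z. \<bar>snd z - y\<bar> > sqrt (2 * V * ln (2 / lam))}"
      using le by (intro measure_pmf.finite_measure_mono) auto
    also have "\<dots> \<le> lam"
    proof (rule prob_abs_gt_le_sub_Gaussian[OF _ V0 assms(6,7)])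
      fix \<theta> :: real
      show "(\<integral>\<^sup>+z. ennreal (exp (\<theta> * (snd z - y))) \<partial>M) \<le> ennreal (exp (\<theta>\<^sup>2 * V / 2))"
        using nn_integral_exp_rec_sum_pair_le[OF assms(1), where \<theta> = \<theta> and k = k and a = a and r = r]
        unfolding M_def V_def A_def u_def assms(4) n .
    qed
    finally show ?thesis .
  qed
  let ?good = "{yhat. \<bar>yhat - y\<bar> / \<bar>y\<bar> \<le> cond_sum n a *
      (R + gam k (u + v) - gam k u)}"
  have sub: "set_pmf M \<inter> - {z. \<bar>snd z - y\<bar> > A * R} \<subseteq> fst -` ?good"
  proof
    fix z assume z: "z \<in> set_pmf M \<inter> - {z. \<bar>snd z - y\<bar> > A * R}"
    hence "(fst z, snd z) \<in> set_pmf (rec_sum_pair p r a (Suc k))" by (simp add: M_def n)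
    from rec_sum_pair_bounds(2)[OF assms(1) this]
    have "\<bar>fst z - snd z\<bar> \<le> A * (gam k (u + v) - gam k u)"
      by (simp add: A_def n u_def v_def gam_def add.assoc)
    moreover have "\<bar>snd z - y\<bar> \<le> A * R" using z by auto
    ultimately have "\<bar>fst z - y\<bar> \<le> A * R + A * (gam k (u + v) - gam k u)" by linarith
    hence "\<bar>fst z - y\<bar> \<le> A * (R + gam k (u + v) - gam k u)" by (simp add: algebra_simps)
    hence "\<bar>fst z - y\<bar> / \<bar>y\<bar> \<le> A * (R + gam k (u + v) - gam k u) / \<bar>y\<bar>"
      by (intro divide_right_mono) auto
    thus "z \<in> fst -` ?good" by (simp add: cond_sum_def A_def assms(4))
  qed
  have "1 - lam \<le> 1 - measure_pmf.prob M {z. \<bar>snd z - y\<bar> > A * R}" using conc by simp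
  also have "\<dots> = measure_pmf.prob M (- {z. \<bar>snd z - y\<bar> > A * R})"
    by (subst measure_pmf.prob_compl[symmetric]) (auto simp: Compl_eq_Diff_UNIV)
  also have "\<dots> \<le> measure_pmf.prob M (fst -` ?good)"
    by (subst measure_Int_set_pmf[symmetric]) (use sub in \<open>intro measure_pmf.finite_measure_mono, auto\<close>)
  also have "\<dots> = measure_pmf.prob (rec_sum p r a n) ?good"
    by (simp only: M_def measure_map_pmf flip: map_fst_rec_sum_pair)
  finally show ?thesis by (simp add: R_def u_def v_def n)
qed

end
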